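(* SocChain satisfies the safety property: in every execution of SocChain with $n$ blockchain nodes of which at most $t<n/3$ are byzantine, the two chains of blocks maintained locally by any two correct blockchain nodes are either identical or one is a prefix of the other.
   Context: Model. There are $n$ blockchain nodes, of which at most $t<n/3$ are byzantine (behave arbitrarily); the others are correct. Communication is by message passing and is partially synchronous (message delays are bounded by an unknown bound). The adversary is computationally bounded; signatures are unforgeable and verifiable. All nodes share the same genesis block $B_0$ and the same initial state $S$. Consensus. The nodes run consensus instances $i=1,2,\dots$. In instance $i$, each node reliably broadcasts a proposal (a list of transactions $\mathit{txs}$ with a timestamp), and the proposal delivered from node $k$ is stored as $\mathit{props}[k]$, $k\in\{0,\dots,n-1\}$. Reliable broadcast guarantees that if a correct node delivers a proposal from $k$ in instance $i$, then every correct node eventually delivers it, and no two correct nodes deliver different proposals from $k$ in instance $i$. For each $k$ the nodes run a binary byzantine consensus, in which a node inputs $1$ if it has delivered $\mathit{props}[k]$ and possibly $0$ otherwise (once at least $n-t$ binary consensus instances have decided $1$ and a timer has expired), and whose decision is stored as $\mathit{bitmask}[k]\in\{0,1\}$. Binary consensus guarantees that no two correct nodes decide differently. When $\mathit{bitmask}$ is full and $\mathit{props}[k]$ has been delivered for all $k$ with $\mathit{bitmask}[k]=1$, the node decides the superblock, which is the sequence, ordered by $k$, of the proposals $\mathit{props}[k]$ with $\mathit{bitmask}[k]=1$. Execution. A correct node executes the superblocks decided in instances $1,2,\dots$ in this order, starting with block index $\ell=1$. To execute a superblock, it treats each of its proposals $\mathit{props}[k]$ in increasing order of $k$ (iteration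 $k$): for every transaction $tx$ in $\mathit{props}[k].\mathit{txs}$ in order, if $\mathrm{isvalid}(tx)$ holds in the current state, then $tx$ is run by a deterministic function on the current state, giving an updated state and a receipt; the receipt is added to $\mathit{receipts}_k$ and $tx$ to $\mathit{val}_k$; invalid transactions are discarded. $S_{next_k}$ denotes the resulting state. Then $\mathit{timestamp}_k$ is set to the timestamp of $\mathit{props}[k]$, $TX_k$ to the transaction trie updated with $\mathit{val}_k$, and $R_k$ to the receipt trie updated with $\mathit{receipts}_k$ (deterministic functions). The block $$B_\ell=\langle h(\mathrm{header}(B_{\ell-1})),h(S_{next_k}),h(TX_k),h(R_k),GU_k,GL,\mathit{nonce},\mathit{timestamp}_k,\mathit{val}_k\rangle$$ is created, where $h$ is a hash function, $GU_k$ is the gas used by the executed transactions, and $GL$ (gas limit) and $\mathit{nonce}$ are common to all nodes. The block $B_\ell$ is appended to the local chain and $\ell$ is incremented. *)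

theory Defs
  imports "HOL-Library.Sublist"
begin

section \<open>Proposals, blocks and the deterministic execution functions\<close>

record 'tx proposal =
  txs :: "'tx list"
  prop_time :: nat

text \<open>
  A block is a tuple of nine components. Its header consists of all components except the last
  one, the list of transactions; it is obtained from a block by \<open>header.truncate\<close>.
\<close>

record 'h header =
  parent_hash :: 'h
  state_hash :: 'h
  tx_trie_hash :: 'h
  receipt_trie_hash :: 'h
  gas_used :: nat
  gas_limit :: nat
  blk_nonce :: nat
  blk_time :: nat

record ('h, 'tx) block = "'h header" +
  blk_txs :: "'tx list"

datatype ('h, 'st, 'txt, 'rct) preimage =
    HHeader "'h header"
  | HState 'st
  | HTxTrie 'txt
  | HReceiptTrie 'rct

text \<open>
  The data common to all nodes. Nothing is assumed about these functions; in particular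
  \<open>hash\<close> need not be collision resistant. Updating a trie may depend on its previous
  contents; tries rebuilt for each block are the special case where it does not.
\<close>

record ('tx, 'st, 'rc, 'h, 'txt, 'rct) params =
  genesis :: "('h, 'tx) block"
  init_state :: 'st
  init_tx_trie :: 'txt
  init_receipt_trie :: 'rct
  isvalid :: "'st \<Rightarrow> 'tx \<Rightarrow> bool"
  run_tx :: "'st \<Rightarrow> 'tx \<Rightarrow> 'st \<times> 'rc"
  gas_of :: "'rc \<Rightarrow> nat"
  update_tx_trie :: "'txt \<Rightarrow> 'tx list \<Rightarrow> 'txt"
  update_receipt_trie :: "'rct \<Rightarrow> 'rc list \<Rightarrow> 'rct"
  hash :: "('h, 'st, 'txt, 'rct) preimage \<Rightarrow> 'h"
  GL :: nat
  nonce :: nat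

text \<open>
  \<open>run_txs P ts s\<close> returns the state reached, the transactions of \<open>ts\<close> that were
  valid when their turn came, and the receipts of these transactions.
\<close>

fun run_txs ::
  "('tx, 'st, 'rc, 'h, 'txt, 'rct) params \<Rightarrow> 'tx list \<Rightarrow> 'st \<Rightarrow> 'st \<times> 'tx list \<times> 'rc list" where
  "run_txs P [] s = (s, [], [])"
| "run_txs P (tx # ts) s =
    (if isvalid P s tx
     then let (s', r) = run_tx P s tx; (s'', vs, rs) = run_txs P ts s' in (s'', tx # vs, r # rs)
     else run_txs P ts s)"


section \<open>Local states and local steps of correct nodes\<close>

text \<open>
  Nodes are the numbers below \<open>n\<close>. The fields indexed by consensus instances and nodes are
  partial: \<open>None\<close> stands for not yet delivered, input, or decided.
  \<open>started\<close> is the last instance whose superblock the node has started to execute, and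
  \<open>todo\<close> lists the proposals of that superblock still to be executed.
  \<open>height\<close> is the index of the next block; position \<open>l\<close> of \<open>chain\<close> holds
  the block with index \<open>l\<close>, the genesis block being at position 0.
\<close>

record ('tx, 'st, 'h, 'txt, 'rct) node_state =
  own_prop :: "nat \<Rightarrow> 'tx proposal option"
  props :: "nat \<Rightarrow> nat \<Rightarrow> 'tx proposal option"
  timer_expired :: "nat \<Rightarrow> bool"
  bin_input :: "nat \<Rightarrow> nat \<Rightarrow> bool option"
  bitmask :: "nat \<Rightarrow> nat \<Rightarrow> bool option"
  superblock :: "nat \<Rightarrow> 'tx proposal list option"
  started :: nat
  todo :: "'tx proposal list"
  state :: 'st
  tx_trie :: 'txt
  receipt_trie :: 'rct
  height :: nat
  chain :: "('h, 'tx) block list"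

definition initial ::
  "('tx, 'st, 'rc, 'h, 'txt, 'rct) params \<Rightarrow> ('tx, 'st, 'h, 'txt, 'rct) node_state" where
  "initial P =
    \<lparr>own_prop = (\<lambda>_. None), props = (\<lambda>_ _. None), timer_expired = (\<lambda>_. False),
     bin_input = (\<lambda>_ _. None), bitmask = (\<lambda>_ _. None), superblock = (\<lambda>_. None),
     started = 0, todo = [], state = init_state P, tx_trie = init_tx_trie P,
     receipt_trie = init_receipt_trie P, height = 1, chain = [genesis P]\<rparr>"

definition upd2 :: "('a \<Rightarrow> 'b \<Rightarrow> 'c) \<Rightarrow> 'a \<Rightarrow> 'b \<Rightarrow> 'c \<Rightarrow> 'a \<Rightarrow> 'b \<Rightarrow> 'c" where
  "upd2 f i k x = f(i := (f i)(k := x))"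

definition superblock_of ::
  "nat \<Rightarrow> (nat \<Rightarrow> bool option) \<Rightarrow> (nat \<Rightarrow> 'tx proposal option) \<Rightarrow> 'tx proposal list" where
  "superblock_of n bm pr = map (\<lambda>k. the (pr k)) (filter (\<lambda>k. bm k = Some True) [0..<n])"

definition execute_proposal ::
  "('tx, 'st, 'rc, 'h, 'txt, 'rct) params \<Rightarrow> 'tx proposal \<Rightarrow>
   ('tx, 'st, 'h, 'txt, 'rct) node_state \<Rightarrow> ('tx, 'st, 'h, 'txt, 'rct) node_state" where
  "execute_proposal P p s =
    (let (st', val, receipts) = run_txs P (txs p) (state s);
         tt' = update_tx_trie P (tx_trie s) val;
         rt' = update_receipt_trie P (receipt_trie s) receipts;
         B = \<lparr>parent_hash = hash P (HHeader (header.truncate (chain s ! (height s - 1)))),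
              state_hash = hash P (HState st'),
              tx_trie_hash = hash P (HTxTrie tt'),
              receipt_trie_hash = hash P (HReceiptTrie rt'),
              gas_used = sum_list (map (gas_of P) receipts),
              gas_limit = GL P,
              blk_nonce = nonce P,
              blk_time = prop_time p,
              blk_txs = val\<rparr>
     in s\<lparr>state := st', tx_trie := tt', receipt_trie := rt',
          chain := chain s @ [B], height := height s + 1\<rparr>)"

text \<open>
  In the actions below, the first argument is the consensus instance. \<open>Deliver\<close> and
  \<open>BinDecide\<close> are the outputs of reliable broadcast and of binary consensus.
  Correct nodes perform the actions of different instances in any interleaving,
  but execute superblocks in the order of the instances.
\<close>

datatype 'tx action =
    Idle
  | Broadcast nat "'tx proposal"
  | Deliver nat nat "'tx proposal"
  | Timeout nat
  | BinInput nat nat bool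
  | BinDecide nat nat bool
  | Decide nat
  | StartExecution
  | ExecuteNext

inductive local_step ::
  "('tx, 'st, 'rc, 'h, 'txt, 'rct) params \<Rightarrow> nat \<Rightarrow> nat \<Rightarrow>
   ('tx, 'st, 'h, 'txt, 'rct) node_state \<Rightarrow> 'tx action \<Rightarrow>
   ('tx, 'st, 'h, 'txt, 'rct) node_state \<Rightarrow> bool"
  for P n t where
  idle:
    "local_step P n t s Idle s"
| broadcast:
    "i \<ge> 1 \<Longrightarrow> own_prop s i = None \<Longrightarrow>
     local_step P n t s (Broadcast i p) (s\<lparr>own_prop := (own_prop s)(i := Some p)\<rparr>)"
| deliver:
    "i \<ge> 1 \<Longrightarrow> k < n \<Longrightarrow> props s i k = None \<Longrightarrow>
     local_step P n t s (Deliver i k p) (s\<lparr>props := upd2 (props s) i k (Some p)\<rparr>)"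
| timeout:
    "i \<ge> 1 \<Longrightarrow>
     local_step P n t s (Timeout i) (s\<lparr>timer_expired := (timer_expired s)(i := True)\<rparr>)"
| input_one:
    "i \<ge> 1 \<Longrightarrow> k < n \<Longrightarrow> bin_input s i k = None \<Longrightarrow> props s i k \<noteq> None \<Longrightarrow>
     local_step P n t s (BinInput i k True) (s\<lparr>bin_input := upd2 (bin_input s) i k (Some True)\<rparr>)"
| input_zero:
    "i \<ge> 1 \<Longrightarrow> k < n \<Longrightarrow> bin_input s i k = None \<Longrightarrow> props s i k = None \<Longrightarrow>
     card {j. j < n \<and> bitmask s i j = Some True} \<ge> n - t \<Longrightarrow> timer_expired s i \<Longrightarrow>
     local_step P n t s (BinInput i k False) (s\<lparr>bin_input := upd2 (bin_input s) i k (Some False)\<rparr>)"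
| bin_decide:
    "i \<ge> 1 \<Longrightarrow> k < n \<Longrightarrow> bitmask s i k = None \<Longrightarrow>
     local_step P n t s (BinDecide i k b) (s\<lparr>bitmask := upd2 (bitmask s) i k (Some b)\<rparr>)"
| decide:
    "i \<ge> 1 \<Longrightarrow> superblock s i = None \<Longrightarrow> (\<forall>k<n. bitmask s i k \<noteq> None) \<Longrightarrow>
     (\<forall>k<n. bitmask s i k = Some True \<longrightarrow> props s i k \<noteq> None) \<Longrightarrow>
     local_step P n t s (Decide i)
       (s\<lparr>superblock := (superblock s)(i := Some (superblock_of n (bitmask s i) (props s i)))\<rparr>)"
| start_execution:
    "todo s = [] \<Longrightarrow> superblock s (started s + 1) = Some ps \<Longrightarrow>
     local_step P n t s StartExecution (s\<lparr>started := started s + 1, todo := ps\<rparr>)"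
| execute_next:
    "todo s = p # ps \<Longrightarrow>
     local_step P n t s ExecuteNext ((execute_proposal P p s)\<lparr>todo := ps\<rparr>)"


section \<open>Executions\<close>

text \<open>
  In an execution, \<open>act \<tau> p\<close> is the action of node \<open>p\<close> at step \<open>\<tau>\<close>
  and \<open>\<sigma> \<tau> p\<close> is its local state before this step. Nothing is required of the
  actions and states of byzantine nodes.
\<close>

definition rb_agreement :: "nat set \<Rightarrow> (nat \<Rightarrow> nat \<Rightarrow> 'tx action) \<Rightarrow> bool" where
  "rb_agreement C act \<longleftrightarrow>
    (\<forall>p\<in>C. \<forall>q\<in>C. \<forall>\<tau> \<tau>' i k m m'.
      act \<tau> p = Deliver i k m \<longrightarrow> act \<tau>' q = Deliver i k m' \<longrightarrow> m = m')"

definition rb_totality :: "nat set \<Rightarrow> (nat \<Rightarrow> nat \<Rightarrow> 'tx action) \<Rightarrow> bool" where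
  "rb_totality C act \<longleftrightarrow>
    (\<forall>p\<in>C. \<forall>q\<in>C. \<forall>\<tau> i k m.
      act \<tau> p = Deliver i k m \<longrightarrow> (\<exists>\<tau>'. act \<tau>' q = Deliver i k m))"

definition bin_agreement :: "nat set \<Rightarrow> (nat \<Rightarrow> nat \<Rightarrow> 'tx action) \<Rightarrow> bool" where
  "bin_agreement C act \<longleftrightarrow>
    (\<forall>p\<in>C. \<forall>q\<in>C. \<forall>\<tau> \<tau>' i k b b'.
      act \<tau> p = BinDecide i k b \<longrightarrow> act \<tau>' q = BinDecide i k b' \<longrightarrow> b = b')"

definition socchain_execution ::
  "('tx, 'st, 'rc, 'h, 'txt, 'rct) params \<Rightarrow> nat \<Rightarrow> nat \<Rightarrow> nat set \<Rightarrow>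
   (nat \<Rightarrow> nat \<Rightarrow> 'tx action) \<Rightarrow>
   (nat \<Rightarrow> nat \<Rightarrow> ('tx, 'st, 'h, 'txt, 'rct) node_state) \<Rightarrow> bool" where
  "socchain_execution P n t C act \<sigma> \<longleftrightarrow>
    (\<forall>p\<in>C. \<sigma> 0 p = initial P) \<and>
    (\<forall>p\<in>C. \<forall>\<tau>. local_step P n t (\<sigma> \<tau> p) (act \<tau> p) (\<sigma> (Suc \<tau>) p)) \<and>
    rb_agreement C act \<and> rb_totality C act \<and> bin_agreement C act"

definition safety ::
  "nat set \<Rightarrow> (nat \<Rightarrow> nat \<Rightarrow> ('tx, 'st, 'h, 'txt, 'rct) node_state) \<Rightarrow> bool" where
  "safety C \<sigma> \<longleftrightarrow>
    (\<forall>\<tau>. \<forall>p\<in>C. \<forall>q\<in>C.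
      chain (\<sigma> \<tau> p) = chain (\<sigma> \<tau> q) \<or>
      prefix (chain (\<sigma> \<tau> p)) (chain (\<sigma> \<tau> q)) \<or>
      prefix (chain (\<sigma> \<tau> q)) (chain (\<sigma> \<tau> p)))"

end

(*
  A superblock is determined by the decided bits and by the proposals delivered for the bits equal
  to 1; neither can change after the superblock is decided, and by agreement of reliable broadcast
  and binary consensus two correct nodes have them in common. The proposals that a correct node has
  executed form a prefix of the concatenation of its superblocks, so the sequences of proposals
  executed by two correct nodes are prefixes of a common sequence. Since execution is deterministic
  and only appends blocks, the chains are comparable as well.
*)
theory Submission
  imports Defs
begin

section \<open>Execution of a sequence of proposals\<close>

text \<open>These are exactly the fields that \<open>execute_proposal\<close> reads and writes. A
  node state and a replay from \<open>initial P\<close> differ in the delivered proposals, bits and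
  superblocks, so the two can be compared only through this projection.\<close>

definition exec_view ::
  "('tx, 'st, 'h, 'txt, 'rct) node_state \<Rightarrow> 'st \<times> 'txt \<times> 'rct \<times> nat \<times> ('h, 'tx) block list" where
  "exec_view s = (state s, tx_trie s, receipt_trie s, height s, chain s)"

lemma exec_view_execute_proposal_cong:
  assumes "exec_view s = exec_view s'"
  shows "exec_view (execute_proposal P p s) = exec_view (execute_proposal P p s')"
  using assms by (simp add: exec_view_def execute_proposal_def Let_def split: prod.split)

lemma prefix_chain_execute_proposal: "prefix (chain s) (chain (execute_proposal P p s))"
  by (simp add: execute_proposal_def Let_def split: prod.split)

lemma prefix_chain_fold_execute_proposal:
  "prefix (chain s) (chain (fold (execute_proposal P) ps s))"
proof (induction ps arbitrary: s)
  case (Cons p ps)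
  then show ?case
    using prefix_chain_execute_proposal[of s P p]
    by (auto intro: prefix_order.trans)
qed simp

lemma prefix_chain_fold_mono:
  assumes "prefix ps qs"
  shows "prefix (chain (fold (execute_proposal P) ps s)) (chain (fold (execute_proposal P) qs s))"
  using assms by (auto simp: prefix_chain_fold_execute_proposal elim!: prefixE)


section \<open>Invariants of correct nodes\<close>

text \<open>Proposals at positions whose bit is not 1 are filtered out before being read. This
  serves twice: for late deliveries at one node and for the comparison of two nodes.\<close>

lemma superblock_of_cong:
  assumes "\<And>k. k < n \<Longrightarrow> bm k = bm' k"
    and "\<And>k. k < n \<Longrightarrow> bm k = Some True \<Longrightarrow> pr k = pr' k"
  shows "superblock_of n bm pr = superblock_of n bm' pr'"
proof -
  have "filter (\<lambda>k. bm k = Some True) [0..<n] = filter (\<lambda>k. bm' k = Some True) [0..<n]"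
    using assms(1) by (intro filter_cong) auto
  then show ?thesis
    unfolding superblock_of_def using assms by (intro map_cong) auto
qed

text \<open>The superblock is tied to the current bits and proposals, not to those at the moment of
  decision, so two nodes can be compared at arbitrary times without going back to their
  decisions.\<close>

definition superblock_inv :: "nat \<Rightarrow> ('tx, 'st, 'h, 'txt, 'rct) node_state \<Rightarrow> bool" where
  "superblock_inv n s \<longleftrightarrow>
    (\<forall>i ps. superblock s i = Some ps \<longrightarrow>
      (\<forall>k<n. bitmask s i k \<noteq> None) \<and>
      (\<forall>k<n. bitmask s i k = Some True \<longrightarrow> props s i k \<noteq> None) \<and>
      ps = superblock_of n (bitmask s i) (props s i))"

definition scheduled :: "('tx, 'st, 'h, 'txt, 'rct) node_state \<Rightarrow> 'tx proposal list" where
  "scheduled s = concat (map (\<lambda>i. the (superblock s i)) [1..<Suc (started s)])"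

text \<open>The first conjunct makes \<open>the\<close> in \<open>scheduled\<close> meaningful. The
  witness \<open>ps\<close> is the list of proposals executed so far; expressing the state as a
  replay of \<open>ps\<close> makes the chain a function of \<open>ps\<close> alone.\<close>

definition execution_inv ::
  "('tx, 'st, 'rc, 'h, 'txt, 'rct) params \<Rightarrow> ('tx, 'st, 'h, 'txt, 'rct) node_state \<Rightarrow> bool" where
  "execution_inv P s \<longleftrightarrow>
    (\<forall>i. 1 \<le> i \<and> i \<le> started s \<longrightarrow> superblock s i \<noteq> None) \<and>
    (\<exists>ps. scheduled s = ps @ todo s \<and>
      exec_view s = exec_view (fold (execute_proposal P) ps (initial P)))"

lemma execute_proposal_frame [simp]:
  "props (execute_proposal P p s) = props s"
  "bitmask (execute_proposal P p s) = bitmask s"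
  "superblock (execute_proposal P p s) = superblock s"
  "started (execute_proposal P p s) = started s"
  by (simp_all add: execute_proposal_def Let_def split: prod.split)

text \<open>Bits and deliveries are write-once. Once a superblock is decided, its bits are all set
  and its selected proposals are all present, so a later delivery in that instance can fill only a
  position with bit 0.\<close>

lemma superblock_inv_step:
  assumes "local_step P n t s a s'" "superblock_inv n s"
  shows "superblock_inv n s'"
  using assms
proof (cases rule: local_step.cases)
  case (deliver i k p)
  have "superblock_of n (bitmask s j) (props s j) = superblock_of n (bitmask s j) (props s' j)"
    if "superblock s j = Some ps" for j ps
    using that assms(2) deliver
    by (intro superblock_of_cong) (fastforce simp: superblock_inv_def upd2_def)+
  then show ?thesis
    using assms(2) deliver by (auto simp: superblock_inv_def upd2_def)
next
  case (bin_decide i k b)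
  \<comment> \<open>A decided superblock would have a full bitmask, whereas bit \<open>k\<close> is
    still open here.\<close>
  then have "superblock s i = None"
    using assms(2) unfolding superblock_inv_def by (meson not_None_eq)
  then show ?thesis
    using assms(2) bin_decide by (auto simp: superblock_inv_def upd2_def)
qed (auto simp: superblock_inv_def)

lemma execution_inv_cong:
  assumes "superblock s' = superblock s" "started s' = started s" "todo s' = todo s"
    and "exec_view s' = exec_view s"
  shows "execution_inv P s' = execution_inv P s"
  using assms by (simp add: execution_inv_def scheduled_def)

lemma execution_inv_step:
  assumes step: "local_step P n t s a s'" and inv: "execution_inv P s"
  shows "execution_inv P s'"
proof -
  from inv obtain ps where dec: "\<And>i. 1 \<le> i \<Longrightarrow> i \<le> started s \<Longrightarrow> superblock s i \<noteq> None"
    and ps: "scheduled s = ps @ todo s"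
      "exec_view s = exec_view (fold (execute_proposal P) ps (initial P))"
    by (auto simp: execution_inv_def)
  have unchanged: "execution_inv P s'"
    if "superblock s' = superblock s" "started s' = started s" "todo s' = todo s"
      "exec_view s' = exec_view s"
    using inv execution_inv_cong[OF that] by blast
  from step show ?thesis
  proof (cases rule: local_step.cases)
    case (decide i)
    \<comment> \<open>Every started instance already has a superblock, and \<open>Decide\<close>
      requires that there is none, so the new superblock lies beyond the scheduled range.\<close>
    have "i \<notin> set [1..<Suc (started s)]"
      using decide dec[of i] by auto
    then have "scheduled s' = scheduled s"
      unfolding scheduled_def using decide
      by (intro arg_cong[where f = concat] map_cong) auto
    moreover have "exec_view s' = exec_view s" "todo s' = todo s"
      using decide by (simp_all add: exec_view_def)
    ultimately show ?thesis
      using ps dec decide by (auto simp: execution_inv_def)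
  next
    case (start_execution qs)
    have "scheduled s' = scheduled s @ qs"
      using start_execution by (simp add: scheduled_def)
    moreover have "exec_view s' = exec_view s"
      using start_execution by (simp add: exec_view_def)
    ultimately show ?thesis
      using ps dec start_execution by (auto simp: execution_inv_def le_Suc_eq)
  next
    case (execute_next p qs)
    have "scheduled s' = (ps @ [p]) @ todo s'"
      using execute_next ps by (simp add: scheduled_def)
    moreover have "exec_view s' = exec_view (execute_proposal P p s)"
      using execute_next by (simp add: exec_view_def)
    then have "exec_view s' = exec_view (fold (execute_proposal P) (ps @ [p]) (initial P))"
      using exec_view_execute_proposal_cong[OF ps(2), of P p] by simp
    ultimately show ?thesis
      using dec execute_next unfolding execution_inv_def by force
  qed (rule unchanged; simp add: exec_view_def)+
qed

text \<open>The agreement properties speak of actions, while superblocks are read off states.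
  Tracing an entry back to the action that wrote it connects the two.\<close>

lemma props_step:
  assumes "local_step P n t s a s'" "props s' i k = Some m"
  shows "props s i k = Some m \<or> a = Deliver i k m"
  using assms by (cases rule: local_step.cases) (auto simp: upd2_def split: if_splits)

lemma bitmask_step:
  assumes "local_step P n t s a s'" "bitmask s' i k = Some b"
  shows "bitmask s i k = Some b \<or> a = BinDecide i k b"
  using assms by (cases rule: local_step.cases) (auto simp: upd2_def split: if_splits)


section \<open>Agreement between correct nodes\<close>

context
  fixes P :: "('tx, 'st, 'rc, 'h, 'txt, 'rct) params"
    and n t :: nat and C :: "nat set"
    and act :: "nat \<Rightarrow> nat \<Rightarrow> 'tx action"
    and \<sigma> :: "nat \<Rightarrow> nat \<Rightarrow> ('tx, 'st, 'h, 'txt, 'rct) node_state"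
  assumes exec: "socchain_execution P n t C act \<sigma>"
begin

lemma initial_state: "p \<in> C \<Longrightarrow> \<sigma> 0 p = initial P"
  using exec by (simp add: socchain_execution_def)

lemma step: "p \<in> C \<Longrightarrow> local_step P n t (\<sigma> \<tau> p) (act \<tau> p) (\<sigma> (Suc \<tau>) p)"
  using exec by (simp add: socchain_execution_def)

lemma superblock_inv_reachable: "p \<in> C \<Longrightarrow> superblock_inv n (\<sigma> \<tau> p)"
proof (induction \<tau>)
  case 0
  then show ?case by (simp add: initial_state superblock_inv_def initial_def)
qed (blast intro: superblock_inv_step step)

lemma execution_inv_reachable: "p \<in> C \<Longrightarrow> execution_inv P (\<sigma> \<tau> p)"
proof (induction \<tau>)
  case 0
  have "scheduled (initial P) = [] @ todo (initial P)"
    by (simp add: scheduled_def initial_def)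
  moreover have "started (initial P) = 0"
    by (simp add: initial_def)
  ultimately show ?case
    using 0 by (auto simp: initial_state execution_inv_def intro: exI[of _ "[]"])
qed (blast intro: execution_inv_step step)

lemma props_delivered:
  "p \<in> C \<Longrightarrow> props (\<sigma> \<tau> p) i k = Some m \<Longrightarrow> \<exists>\<tau>'. act \<tau>' p = Deliver i k m"
proof (induction \<tau>)
  case 0
  then show ?case by (simp add: initial_state initial_def)
qed (blast dest: props_step[OF step])

lemma bitmask_decided:
  "p \<in> C \<Longrightarrow> bitmask (\<sigma> \<tau> p) i k = Some b \<Longrightarrow> \<exists>\<tau>'. act \<tau>' p = BinDecide i k b"
proof (induction \<tau>)
  case 0
  then show ?case by (simp add: initial_state initial_def)
qed (blast dest: bitmask_step[OF step])

lemma props_agree: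
  assumes "p \<in> C" "q \<in> C"
    and "props (\<sigma> \<tau> p) i k = Some m" "props (\<sigma> \<tau>' q) i k = Some m'"
  shows "m = m'"
  using exec props_delivered[OF assms(1,3)] props_delivered[OF assms(2,4)] assms(1,2)
  unfolding socchain_execution_def rb_agreement_def by blast

lemma bitmask_agree:
  assumes "p \<in> C" "q \<in> C"
    and "bitmask (\<sigma> \<tau> p) i k = Some b" "bitmask (\<sigma> \<tau>' q) i k = Some b'"
  shows "b = b'"
  using exec bitmask_decided[OF assms(1,3)] bitmask_decided[OF assms(2,4)] assms(1,2)
  unfolding socchain_execution_def bin_agreement_def by blast

text \<open>By \<open>superblock_inv\<close> both nodes have every bit decided and every selected
  proposal delivered, so agreement on entries present at both nodes covers everything that a
  superblock depends on.\<close>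

lemma superblock_agree:
  assumes pq: "p \<in> C" "q \<in> C"
    and sb: "superblock (\<sigma> \<tau> p) i = Some ps" "superblock (\<sigma> \<tau>' q) i = Some qs"
  shows "ps = qs"
proof -
  let ?s = "\<sigma> \<tau> p" and ?s' = "\<sigma> \<tau>' q"
  have inv: "superblock_inv n ?s" "superblock_inv n ?s'"
    using pq by (auto intro: superblock_inv_reachable)
  have bm: "bitmask ?s i k = bitmask ?s' i k" if k: "k < n" for k
  proof -
    obtain b b' where "bitmask ?s i k = Some b" "bitmask ?s' i k = Some b'"
      using inv sb k unfolding superblock_inv_def by blast
    then show ?thesis
      using bitmask_agree[OF pq] by simp
  qed
  have "props ?s i k = props ?s' i k" if k: "k < n" "bitmask ?s i k = Some True" for k
  proof -
    have "bitmask ?s' i k = Some True"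
      using k bm by simp
    then obtain m m' where "props ?s i k = Some m" "props ?s' i k = Some m'"
      using inv sb k unfolding superblock_inv_def by blast
    then show ?thesis
      using props_agree[OF pq] by simp
  qed
  with bm have "superblock_of n (bitmask ?s i) (props ?s i) =
      superblock_of n (bitmask ?s' i) (props ?s' i)"
    by (intro superblock_of_cong)
  then show ?thesis
    using inv sb by (simp add: superblock_inv_def)
qed

text \<open>The instances started by \<open>p\<close> are among those started by \<open>q\<close>,
  and the two nodes have the same superblock in each; the further instances of \<open>q\<close> only
  append proposals.\<close>

lemma scheduled_prefix:
  assumes pq: "p \<in> C" "q \<in> C" and le: "started (\<sigma> \<tau> p) \<le> started (\<sigma> \<tau>' q)"
  shows "prefix (scheduled (\<sigma> \<tau> p)) (scheduled (\<sigma> \<tau>' q))"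
proof -
  let ?s = "\<sigma> \<tau> p" and ?s' = "\<sigma> \<tau>' q"
  have "superblock ?s i = superblock ?s' i" if "1 \<le> i" "i \<le> started ?s" for i
  proof -
    have "superblock ?s i \<noteq> None" "superblock ?s' i \<noteq> None"
      using that le pq execution_inv_reachable[of p \<tau>] execution_inv_reachable[of q \<tau>']
      by (auto simp: execution_inv_def)
    then show ?thesis
      using superblock_agree[OF pq, of \<tau> i _ \<tau>'] by auto
  qed
  then have "scheduled ?s = concat (map (\<lambda>i. the (superblock ?s' i)) [1..<Suc (started ?s)])"
    unfolding scheduled_def by (intro arg_cong[where f = concat] map_cong) auto
  moreover have "[1..<Suc (started ?s')] =
      [1..<Suc (started ?s)] @ [Suc (started ?s)..<Suc (started ?s')]"
    using le upt_add_eq_append[of 1 "Suc (started ?s)" "started ?s' - started ?s"] by simp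
  ultimately show ?thesis
    by (simp add: scheduled_def del: upt_Suc)
qed

lemma chain_replay:
  assumes "p \<in> C"
  obtains ps where "prefix ps (scheduled (\<sigma> \<tau> p))"
    and "chain (\<sigma> \<tau> p) = chain (fold (execute_proposal P) ps (initial P))"
proof -
  obtain ps where "scheduled (\<sigma> \<tau> p) = ps @ todo (\<sigma> \<tau> p)"
      "exec_view (\<sigma> \<tau> p) = exec_view (fold (execute_proposal P) ps (initial P))"
    using execution_inv_reachable[OF assms, of \<tau>] by (auto simp: execution_inv_def)
  then show ?thesis
    by (intro that[of ps]) (simp_all add: exec_view_def)
qed

lemma chains_comparable:
  assumes pq: "p \<in> C" "q \<in> C"
  shows "prefix (chain (\<sigma> \<tau> p)) (chain (\<sigma> \<tau>' q)) \<or> prefix (chain (\<sigma> \<tau>' q)) (chain (\<sigma> \<tau> p))"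
proof -
  obtain ps where ps: "prefix ps (scheduled (\<sigma> \<tau> p))"
      "chain (\<sigma> \<tau> p) = chain (fold (execute_proposal P) ps (initial P))"
    using chain_replay[OF pq(1)] .
  obtain qs where qs: "prefix qs (scheduled (\<sigma> \<tau>' q))"
      "chain (\<sigma> \<tau>' q) = chain (fold (execute_proposal P) qs (initial P))"
    using chain_replay[OF pq(2)] .
  have "prefix (scheduled (\<sigma> \<tau> p)) (scheduled (\<sigma> \<tau>' q)) \<or>
      prefix (scheduled (\<sigma> \<tau>' q)) (scheduled (\<sigma> \<tau> p))"
    using scheduled_prefix pq nat_le_linear by blast
  \<comment> \<open>The longer schedule has both \<open>ps\<close> and \<open>qs\<close> as
    prefixes, and two prefixes of one list are comparable.\<close>
  then have "prefix ps qs \<or> prefix qs ps"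
    using ps(1) qs(1) by (meson prefix_order.trans prefix_same_cases)
  then show ?thesis
    using ps(2) qs(2) prefix_chain_fold_mono by metis
qed

end

theorem theorem3:
  fixes P :: "('tx, 'st, 'rc, 'h, 'txt, 'rct) params"
    and n t :: nat
    and Byz :: "nat set"
    and act :: "nat \<Rightarrow> nat \<Rightarrow> 'tx action"
    and \<sigma> :: "nat \<Rightarrow> nat \<Rightarrow> ('tx, 'st, 'h, 'txt, 'rct) node_state"
  assumes "3 * t < n"
    and "Byz \<subseteq> {0..<n}" and "card Byz \<le> t"
    and "socchain_execution P n t ({0..<n} - Byz) act \<sigma>"
  shows "safety ({0..<n} - Byz) \<sigma>"
  unfolding safety_def using chains_comparable[OF assms(4)] by blast

end
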